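(* Let $X_1,X_2,Y_1,Y_2>0$ and $w_{21},w_{22}>0$, let $\mathbf{X}=(X_1,X_2)$, $\mathbf{Y}=(Y_1,Y_2)$, and $$W=\begin{bmatrix}1&0\\ w_{21}&w_{22}\end{bmatrix}.$$ Consider the networked defense weakest-link game $\mathrm{NDWL}(W,\mathbf{X},\mathbf{Y})$ with two attack types and two defender resource types. Let $$s^\star=\min\left\{1,\ \max\left\{0,\ \frac{\sqrt{Y_1w_{21}}\,X_2-\sqrt{Y_2/w_{22}}\,X_1}{X_2\left(\sqrt{Y_1w_{21}}+w_{21}\sqrt{Y_2/w_{22}}\right)}\right\}\right\}$$ and $$\alpha^\star=\frac{Y_1}{X_1+s^\star w_{21}X_2}+\frac{Y_2}{(1-s^\star)w_{22}X_2}.$$ Then the game has an equilibrium value $V$, i.e. $$V=\sup_{F_{\mathcal{X}}\in\mathcal{F}_{\mathcal{X}}(\mathbf{X})}\inf_{F_{\mathcal{Y}}\in\mathcal{F}_{\mathcal{Y}}(\mathbf{Y})}\pi_{\mathcal{X}}(F_{\mathcal{X}},F_{\mathcal{Y}})=\inf_{F_{\mathcal{Y}}\in\mathcal{F}_{\mathcal{Y}}(\mathbf{Y})}\sup_{F_{\mathcal{X}}\in\mathcal{F}_{\mathcal{X}}(\mathbf{X})}\pi_{\mathcal{X}}(F_{\mathcal{X}},F_{\mathcal{Y}}),$$ and it is given by $$V=\begin{cases}1-\dfrac{\alpha^\star}{2}, & \alpha^\star\le 1,\\[6pt] \dfrac{1}{2\alpha^\star}, & \alpha^\star\ge 1.\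end{cases}$$
   Context: For integers $m,n\ge1$, a matrix $W=[w_{j,i}]\in\mathbb{R}_+^{m\times n}$ and positive budget vectors $\mathbf{X}=(X_1,\dots,X_m)$, $\mathbf{Y}=(Y_1,\dots,Y_n)$, the game $\mathrm{NDWL}(W,\mathbf{X},\mathbf{Y})$ is played between a defender $\mathcal{X}$ with $m$ resource types and an attacker $\mathcal{Y}$ with $n$ attack types. The entry $w_{j,i}$ (row $j$, column $i$; also written $w_{ji}$) is the effectiveness of defender resource type $j$ against attack type $i$. In the claim $m=n=2$. A defender allocation is a matrix $\boldsymbol{x}=(x_{i,j})_{1\le i\le n,\,1\le j\le m}\in\mathbb{R}_+^{n\times m}$, where $x_{i,j}$ is the amount of resource type $j$ used against attack type $i$. An attacker allocation is a vector $y=(y_1,\dots,y_n)\in\mathbb{R}_+^n$. Here $\mathbb{R}_+=[0,\infty)$. Mixed strategies: $\mathcal{F}_{\mathcal{X}}(\mathbf{X})$ is the set of all probability distributions $F_{\mathcal{X}}$ on $\mathbb{R}_+^{n\times m}$ with $\mathbb{E}_{\boldsymbol{x}\sim F_{\mathcal{X}}}\big[\sum_{i=1}^n x_{i,j}\big]=X_j$ for every $j=1,\dots,m$. $\mathcal{F}_{\mathcal{Y}}(\mathbf{Y})$ is the set of all probability distributions $F_{\mathcal{Y}}$ on $\mathbb{R}_+^n$ with $\mathbb{E}_{y\sim F_{\mathcal{Y}}}[y_i]=Y_i$ for every $i=1,\dots,n$. The defender's expected payoff, with $\boldsymbol{x}\sim F_{\mathcal{X}}$ and $y\sim F_{\mathcal{Y}}$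 drawn independently, is $$\pi_{\mathcal{X}}(F_{\mathcal{X}},F_{\mathcal{Y}})=\mathbb{E}_{\boldsymbol{x}\sim F_{\mathcal{X}},\,y\sim F_{\mathcal{Y}}}\Big[\mathbf{1}\Big\{\sum_{j=1}^m w_{j,i}x_{i,j}\ge y_i\ \ \forall i=1,\dots,n\Big\}\Big].$$ The equilibrium value of the game is the common value of the defender's max-min value $\sup_{F_{\mathcal{X}}}\inf_{F_{\mathcal{Y}}}\pi_{\mathcal{X}}$ and min-max value $\inf_{F_{\mathcal{Y}}}\sup_{F_{\mathcal{X}}}\pi_{\mathcal{X}}$, when these are equal. *)

theory Defs
  imports "HOL-Probability.Probability"
begin

text \<open>
  The index type \<open>'m\<close> enumerates defender resource types and \<open>'n\<close> attack types.
  The effectiveness matrix \<open>W\<close> is indexed \<open>W $ j $ i\<close> (resource type, then attack type), whereas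
  a defender allocation \<open>x\<close> is indexed \<open>x $ i $ j\<close> (attack type, then resource type).

  A probability distribution on the nonnegative orthant is represented by a Borel probability
  measure on the whole space for which almost every point is nonnegative. Using
  \<open>has_bochner_integral\<close> for the budgets makes integrability part of the constraint: the bare
  Bochner integral of a non-integrable function is 0.
\<close>

definition defender_strategies :: "real ^ 'm \<Rightarrow> (real ^ 'm ^ 'n) measure set" where
  "defender_strategies X = {F. prob_space F \<and> sets F = sets borel \<and>
     (AE x in F. \<forall>i j. 0 \<le> x $ i $ j) \<and>
     (\<forall>j. has_bochner_integral F (\<lambda>x. \<Sum>i\<in>UNIV. x $ i $ j) (X $ j))}"

definition attacker_strategies :: "real ^ 'n \<Rightarrow> (real ^ 'n) measure set" where
  "attacker_strategies Y = {F. prob_space F \<and> sets F = sets borel \<and>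
     (AE y in F. \<forall>i. 0 \<le> y $ i) \<and>
     (\<forall>i. has_bochner_integral F (\<lambda>y. y $ i) (Y $ i))}"

definition defender_payoff ::
  "real ^ 'n ^ 'm \<Rightarrow> (real ^ 'm ^ 'n) measure \<Rightarrow> (real ^ 'n) measure \<Rightarrow> real" where
  "defender_payoff W FX FY =
     (LINT z|(FX \<Otimes>\<^sub>M FY).
        indicator {(x, y). \<forall>i. (\<Sum>j\<in>UNIV. W $ j $ i * x $ i $ j) \<ge> y $ i} z)"

text \<open>
  Payoffs lie in the unit interval, and both strategy sets are nonempty for nonnegative budgets
  (point masses), so the suprema and infima below are genuine ones in the reals.
\<close>

definition maxmin_value :: "real ^ 'n ^ 'm \<Rightarrow> real ^ 'm \<Rightarrow> real ^ 'n \<Rightarrow> real" where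
  "maxmin_value W X Y =
     (SUP FX\<in>defender_strategies X. INF FY\<in>attacker_strategies Y. defender_payoff W FX FY)"

definition minmax_value :: "real ^ 'n ^ 'm \<Rightarrow> real ^ 'm \<Rightarrow> real ^ 'n \<Rightarrow> real" where
  "minmax_value W X Y =
     (INF FY\<in>attacker_strategies Y. SUP FX\<in>defender_strategies X. defender_payoff W FX FY)"

definition is_equilibrium_value ::
  "real ^ 'n ^ 'm \<Rightarrow> real ^ 'm \<Rightarrow> real ^ 'n \<Rightarrow> real \<Rightarrow> bool" where
  "is_equilibrium_value W X Y V \<longleftrightarrow> V = maxmin_value W X Y \<and> V = minmax_value W X Y"

end

theory Submission imports Defs
begin

text \<open>
  A split \<open>s\<close> of the second resource gives the defender effective budgets
  \<open>V1 = X1 + s w21 X2\<close> and \<open>V2 = (1 - s) w22 X2\<close>. The defender plays \<open>T (V1, V2)\<close> with a common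
  random factor \<open>T\<close> of mean 1; an attack \<open>y\<close> is then repelled as soon as \<open>T \<ge> y1/V1 + y2/V2\<close>, a
  quantity of mean \<open>\<alpha>\<close>, so the game reduces to a scalar Lotto game with budgets 1 and \<open>\<alpha>\<close>.
  Conversely the attacker strikes a single target \<open>i\<close>, with probability \<open>Yi / (Vi \<beta>)\<close> for
  \<open>\<beta> = max 1 \<alpha>\<close>, uniformly on \<open>[0, 2 \<beta> Vi]\<close>. The defender's payoff is then bounded by a linear
  function of the allocation, with slope proportional to \<open>Yi / Vi^2\<close> in the effective resource at
  \<open>i\<close>. The choice of \<open>s\<close> minimising \<open>\<alpha>\<close> is exactly the first-order condition under which no
  reallocation beats this split, and the two guarantees coincide.
\<close>

subsection \<open>Payoffs by Fubini\<close>

definition covered :: "real ^ 'n ^ 'm \<Rightarrow> ((real ^ 'm ^ 'n) \<times> (real ^ 'n)) set" where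
  "covered W = {(x, y). \<forall>i. y $ i \<le> (\<Sum>j\<in>UNIV. W $ j $ i * x $ i $ j)}"

text \<open>The event is cut out by finitely many non-strict inequalities between continuous
  functions, hence closed; the product of the two Borel sigma-algebras is the Borel sigma-algebra of
  the product space.\<close>

lemma covered_measurable:
  assumes "sets M = sets borel" "sets N = sets borel"
  shows "covered W \<in> sets (M \<Otimes>\<^sub>M N)"
proof -
  have "closed (covered W)"
    unfolding covered_def case_prod_beta'
    by (intro closed_Collect_all closed_Collect_le continuous_intros)
  then have "covered W \<in> sets borel" by simp
  then show ?thesis
    unfolding sets_pair_measure_cong[OF assms] borel_prod .
qed

lemma measurable_slices:
  "{y. (x, y) \<in> covered W} \<in> sets borel" "{x. (x, y) \<in> covered W} \<in> sets borel"
proof -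
  have "closed {y. (x, y) \<in> covered W}" "closed {x. (x, y) \<in> covered W}"
    unfolding covered_def mem_Collect_eq case_prod_conv
    by (intro closed_Collect_all closed_Collect_le continuous_intros)+
  then show "{y. (x, y) \<in> covered W} \<in> sets borel" "{x. (x, y) \<in> covered W} \<in> sets borel"
    by simp_all
qed

context
  fixes W :: "real ^ 'n ^ 'm" and X :: "real ^ 'm" and Y :: "real ^ 'n"
    and FX :: "(real ^ 'm ^ 'n) measure" and FY :: "(real ^ 'n) measure"
  assumes FX: "FX \<in> defender_strategies X" and FY: "FY \<in> attacker_strategies Y"
begin

interpretation DX: prob_space FX using FX by (simp add: defender_strategies_def)
interpretation DY: prob_space FY using FY by (simp add: attacker_strategies_def)
interpretation P: pair_prob_space FX FY ..

lemma sets_strategies: "sets FX = sets borel" "sets FY = sets borel"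
  using FX FY by (simp_all add: defender_strategies_def attacker_strategies_def)

lemma defender_payoff_eq_measure:
  "defender_payoff W FX FY = P.prob (covered W)"
  using covered_measurable[OF sets_strategies]
  by (simp add: defender_payoff_def covered_def)

lemma defender_payoff_bounds: "0 \<le> defender_payoff W FX FY" "defender_payoff W FX FY \<le> 1"
  by (simp_all add: defender_payoff_eq_measure)

lemma integrable_covered: "integrable (FX \<Otimes>\<^sub>M FY) (indicator (covered W) :: _ \<Rightarrow> real)"
  using covered_measurable[OF sets_strategies] by (intro P.integrable_const_bound[of _ 1]) auto

text \<open>Conditioning on the allocation \<open>x\<close> turns a pointwise bound on the
  attacker's box probabilities into a bound on the payoff. Integrability is part of the claim
  because monotonicity of the integral asks for it.\<close>

lemma has_bochner_integral_defender_slices: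
  "has_bochner_integral FX (\<lambda>x. measure FY {y. (x, y) \<in> covered W}) (defender_payoff W FX FY)"
proof -
  have eq: "(LINT y|FY. indicator (covered W) (x, y)) = measure FY {y. (x, y) \<in> covered W}" for x
  proof -
    have "(\<lambda>y. indicator (covered W) (x, y) :: real) = indicator {y. (x, y) \<in> covered W}"
      by (auto simp: indicator_def)
    then show ?thesis
      using sets_eq_imp_space_eq[OF sets_strategies(2)] by simp
  qed
  show ?thesis
    using P.integrable_fst'[OF integrable_covered] P.integral_fst'[OF integrable_covered]
    by (simp add: eq has_bochner_integral_iff defender_payoff_eq_measure
        covered_measurable[OF sets_strategies] sets.sets_into_space Int_absorb2)
qed

lemma has_bochner_integral_attacker_slices:
  "has_bochner_integral FY (\<lambda>y. measure FX {x. (x, y) \<in> covered W}) (defender_payoff W FX FY)"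
proof -
  have eq: "(LINT x|FX. indicator (covered W) (x, y)) = measure FX {x. (x, y) \<in> covered W}" for y
  proof -
    have "(\<lambda>x. indicator (covered W) (x, y) :: real) = indicator {x. (x, y) \<in> covered W}"
      by (auto simp: indicator_def)
    then show ?thesis
      using sets_eq_imp_space_eq[OF sets_strategies(1)] by simp
  qed
  have i: "integrable (FX \<Otimes>\<^sub>M FY) (\<lambda>(x, y). indicator (covered W) (x, y) :: real)"
    using integrable_covered by (simp add: case_prod_beta')
  show ?thesis
    using P.integrable_snd[OF i] P.integral_snd[OF i]
    by (simp add: eq has_bochner_integral_iff defender_payoff_eq_measure case_prod_beta'
        covered_measurable[OF sets_strategies] sets.sets_into_space Int_absorb2)
qed

end

section \<open>From a saddle point to the value of the game\<close>

text \<open>\<open>FY\<close> caps every inner infimum at \<open>v\<close> and \<open>FX\<close>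
  lifts every inner supremum to \<open>v\<close>, while the outer extrema reach \<open>v\<close> at
  these two strategies. The bounds 0 and 1 on payoffs make the real suprema and infima
  genuine.\<close>

lemma saddle_point_is_value:
  assumes FX: "FX \<in> defender_strategies X" and FY: "FY \<in> attacker_strategies Y"
    and lower: "\<And>G. G \<in> attacker_strategies Y \<Longrightarrow> v \<le> defender_payoff W FX G"
    and upper: "\<And>F. F \<in> defender_strategies X \<Longrightarrow> defender_payoff W F FY \<le> v"
  shows "is_equilibrium_value W X Y v"
proof -
  let ?A = "defender_strategies X" and ?B = "attacker_strategies Y"
  have bb: "bdd_below ((\<lambda>G. defender_payoff W F G) ` ?B)" if "F \<in> ?A" for F
    using that by (intro bdd_belowI2[of _ 0]) (auto intro: defender_payoff_bounds)
  have ba: "bdd_above ((\<lambda>F. defender_payoff W F G) ` ?A)" if "G \<in> ?B" for G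
    using that by (intro bdd_aboveI2[of _ _ 1]) (auto intro: defender_payoff_bounds)
  have inf_le: "(INF G\<in>?B. defender_payoff W F G) \<le> v" if "F \<in> ?A" for F
    by (rule cINF_lower2[OF bb[OF that] FY upper[OF that]])
  have sup_ge: "v \<le> (SUP F\<in>?A. defender_payoff W F G)" if "G \<in> ?B" for G
    by (rule cSUP_upper2[OF ba[OF that] FX lower[OF that]])
  have "maxmin_value W X Y \<le> v"
    unfolding maxmin_value_def using FX inf_le by (intro cSUP_least) auto
  moreover have "v \<le> maxmin_value W X Y"
    unfolding maxmin_value_def
  proof (rule cSUP_upper2[OF _ FX])
    show "bdd_above ((\<lambda>F. INF G\<in>?B. defender_payoff W F G) ` ?A)"
      using inf_le by (rule bdd_aboveI2)
    show "v \<le> (INF G\<in>?B. defender_payoff W FX G)"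
      using FY lower by (intro cINF_greatest) auto
  qed
  moreover have "v \<le> minmax_value W X Y"
    unfolding minmax_value_def using FY sup_ge by (intro cINF_greatest) auto
  moreover have "minmax_value W X Y \<le> v"
    unfolding minmax_value_def
  proof (rule cINF_lower2[OF _ FY])
    show "bdd_below ((\<lambda>G. SUP F\<in>?A. defender_payoff W F G) ` ?B)"
      using sup_ge by (rule bdd_belowI2)
    show "(SUP F\<in>?A. defender_payoff W F FY) \<le> v"
      using FX upper by (intro cSUP_least) auto
  qed
  ultimately show ?thesis by (simp add: is_equilibrium_value_def)
qed

subsection \<open>Ramps over the unit interval\<close>

text \<open>Common source of randomness: both optimal strategies are images of this measure, so
  their probabilities become lengths of subintervals of [0, 1].\<close>

definition unit_uniform :: "real measure" where
  "unit_uniform = density lborel (\<lambda>u. ennreal (indicator {0..1} u))"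

lemma sets_unit_uniform [simp, measurable_cong]: "sets unit_uniform = sets borel"
  by (simp add: unit_uniform_def)

lemma space_unit_uniform [simp]: "space unit_uniform = UNIV"
  by (simp add: unit_uniform_def)

lemma emeasure_unit_uniform:
  assumes "A \<in> sets borel"
  shows "emeasure unit_uniform A = emeasure lborel ({0..1} \<inter> A)"
proof -
  have "emeasure unit_uniform A = (\<integral>\<^sup>+u. ennreal (indicator {0..1} u) * indicator A u \<partial>lborel)"
    using assms by (simp add: unit_uniform_def emeasure_density del: ennreal_indicator)
  also have "\<dots> = (\<integral>\<^sup>+u. indicator ({0..1} \<inter> A) u \<partial>lborel)"
    by (rule nn_integral_cong) (simp split: split_indicator)
  finally show ?thesis using assms by simp
qed

interpretation unit_uniform: prob_space unit_uniform
  by (rule prob_spaceI) (simp add: emeasure_unit_uniform)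

lemma measure_unit_uniform:
  assumes "A \<in> sets borel"
  shows "measure unit_uniform A = measure lborel ({0..1} \<inter> A)"
  using emeasure_unit_uniform[OF assms] by (simp add: measure_def)

text \<open>For \<open>b < a\<close> the left side is negative, so the interval may be empty and no
  case distinction is left to the caller.\<close>

lemma measure_unit_uniform_ge:
  fixes a b :: real
  assumes "A \<in> sets borel" "{a..b} \<subseteq> A" "0 \<le> a" "b \<le> 1"
  shows "b - a \<le> measure unit_uniform A"
proof (cases "a \<le> b")
  case True
  then have "b - a = measure unit_uniform {a..b}"
    using assms by (simp add: measure_unit_uniform Int_absorb1)
  also have "\<dots> \<le> measure unit_uniform A"
    using assms by (intro unit_uniform.finite_measure_mono) auto
  finally show ?thesis .
next
  case False
  then show ?thesis using measure_nonneg[of unit_uniform A] by linarith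
qed

lemma measure_unit_uniform_atLeastAtMost_le:
  fixes a b :: real
  assumes "a \<le> b"
  shows "measure unit_uniform {a..b} \<le> b - a"
  using assms by (auto simp: measure_unit_uniform)

lemma measure_unit_uniform_mono:
  assumes "A \<in> sets borel" "B \<in> sets borel" "{0..1} \<inter> A \<subseteq> B"
  shows "measure unit_uniform A \<le> measure unit_uniform B"
proof -
  have "measure unit_uniform A = measure unit_uniform ({0..1} \<inter> A)"
    using assms by (simp add: measure_unit_uniform)
  also have "\<dots> \<le> measure unit_uniform B"
    using assms by (intro unit_uniform.finite_measure_mono) auto
  finally show ?thesis .
qed

text \<open>For \<open>0 < k\<close> and \<open>0 \<le> a < b \<le> 1\<close>, its law under
  \<open>unit_uniform\<close> is the classical Lotto marginal: uniform on
  \<open>[0, k * (b - a)]\<close> with probability \<open>b - a\<close>, and otherwise an atom at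
  0.\<close>

definition ramp :: "real \<Rightarrow> real \<Rightarrow> real \<Rightarrow> real \<Rightarrow> real" where
  "ramp k a b u = k * (u - a) * indicator {a..b} u"

lemma ramp_measurable [measurable]: "ramp k a b \<in> borel_measurable borel"
  unfolding ramp_def by measurable

lemma ramp_nonneg: "0 \<le> k \<Longrightarrow> 0 \<le> ramp k a b u"
  by (auto simp: ramp_def indicator_def)

lemma has_bochner_integral_ramp:
  assumes "0 \<le> k" "0 \<le> a" "a \<le> b" "b \<le> 1"
  shows "has_bochner_integral unit_uniform (ramp k a b) (k * (b - a)\<^sup>2 / 2)"
proof -
  have "has_bochner_integral lborel (\<lambda>u. k * (u - a) * indicator {a..b} u)
      (k * (b - a)\<^sup>2 / 2 - k * (a - a)\<^sup>2 / 2)"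
    using assms
    by (intro has_bochner_integral_FTC_Icc_nonneg[where F = "\<lambda>u. k * (u - a)\<^sup>2 / 2"])
       (auto intro!: derivative_eq_intros)
  moreover have "(\<lambda>u. k * (u - a) * indicator {a..b} u) = (\<lambda>u. indicator {0..1} u *\<^sub>R ramp k a b u)"
    using assms by (auto simp: ramp_def indicator_def)
  ultimately show ?thesis
    unfolding unit_uniform_def by (intro has_bochner_integral_density) auto
qed


subsection \<open>Optimal strategies\<close>

text \<open>Scaling \<open>x0\<close> by a nonnegative factor of mean 1 keeps the expected budgets.
  Asking the factor to exceed the sum of the ratios \<open>y $ i / V $ i\<close>, rather than each
  one, gives a bound affine in \<open>y\<close>, whose expectation depends only on
  \<open>Y\<close>.\<close>

lemma proportional_defender:
  fixes x0 :: "real ^ 'm ^ 'n" and X :: "real ^ 'm" and W :: "real ^ 'n ^ 'm" and V :: "real ^ 'n"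
  assumes x0: "\<And>i j. 0 \<le> x0 $ i $ j"
    and X: "\<And>j. (\<Sum>i\<in>UNIV. x0 $ i $ j) = X $ j"
    and V: "\<And>i. (\<Sum>j\<in>UNIV. W $ j $ i * x0 $ i $ j) = V $ i" "\<And>i. 0 < V $ i"
    and \<beta>: "1 \<le> \<beta>"
  obtains FX where "FX \<in> defender_strategies X"
    "\<And>Y FY. FY \<in> attacker_strategies Y \<Longrightarrow>
       1 / \<beta> - (\<Sum>i\<in>UNIV. Y $ i / V $ i) / (2 * \<beta>\<^sup>2) \<le> defender_payoff W FX FY"
proof
  \<comment> \<open>\<open>T\<close> is uniform on \<open>[0, 2 * \<beta>]\<close> with probability
    \<open>1 / \<beta>\<close> and 0 otherwise, so its mean is 1.\<close>
  define T where "T = ramp (2 * \<beta>\<^sup>2) 0 (1 / \<beta>)"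
  define FX where "FX = distr unit_uniform borel (\<lambda>u. T u *\<^sub>R x0)"
  have T_meas [measurable]: "T \<in> borel_measurable borel"
    unfolding T_def by measurable
  have T_nonneg: "0 \<le> T u" for u
    unfolding T_def by (rule ramp_nonneg) simp
  have T_mean: "has_bochner_integral unit_uniform T 1"
    using has_bochner_integral_ramp[of "2 * \<beta>\<^sup>2" 0 "1 / \<beta>"] \<beta>
    by (simp add: T_def power_divide)
  have meas: "(\<lambda>u. T u *\<^sub>R x0) \<in> measurable unit_uniform borel"
    by measurable
  have "AE x in FX. \<forall>i j. 0 \<le> x $ i $ j"
  proof -
    have "closed {x :: real ^ 'm ^ 'n. \<forall>i j. 0 \<le> x $ i $ j}"
      by (intro closed_Collect_all closed_Collect_le continuous_intros)
    then show ?thesis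
      unfolding FX_def using x0 T_nonneg by (subst AE_distr_iff[OF meas]) auto
  qed
  moreover have "has_bochner_integral FX (\<lambda>x. \<Sum>i\<in>UNIV. x $ i $ j) (X $ j)" for j
    unfolding FX_def
  proof (rule has_bochner_integral_distr[OF _ meas])
    show "(\<lambda>x :: real ^ 'm ^ 'n. \<Sum>i\<in>UNIV. x $ i $ j) \<in> borel_measurable borel"
      by (intro borel_measurable_continuous_onI continuous_intros)
    show "has_bochner_integral unit_uniform (\<lambda>u. \<Sum>i\<in>UNIV. (T u *\<^sub>R x0) $ i $ j) (X $ j)"
    proof -
      have "has_bochner_integral unit_uniform (\<lambda>u. T u * X $ j) (1 * X $ j)"
        by (intro has_bochner_integral_mult_left T_mean)
      then show ?thesis by (simp add: X sum_distrib_left[symmetric])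
    qed
  qed
  moreover have "prob_space FX" "sets FX = sets borel"
    by (auto simp: FX_def intro!: unit_uniform.prob_space_distr meas)
  ultimately show FX: "FX \<in> defender_strategies X"
    by (simp add: defender_strategies_def)

  fix Y :: "real ^ 'n" and FY
  assume FY: "FY \<in> attacker_strategies Y"
  interpret DY: prob_space FY using FY by (simp add: attacker_strategies_def)
  let ?g = "\<lambda>y. 1 / \<beta> - (\<Sum>i\<in>UNIV. y $ i / V $ i) / (2 * \<beta>\<^sup>2)"
  have slice: "?g y \<le> measure FX {x. (x, y) \<in> covered W}" if y: "\<forall>i. 0 \<le> y $ i" for y
  proof -
    let ?A = "(\<lambda>u. T u *\<^sub>R x0) -` {x. (x, y) \<in> covered W}"
    have "?A \<in> sets borel"
      using measurable_sets[OF meas measurable_slices(2)] by simp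
    \<comment> \<open>On this interval \<open>T u = 2 * \<beta>\<^sup>2 * u\<close> is at least the
      sum of the ratios. The interval is empty for large \<open>y\<close>, where \<open>?g y\<close>
      is negative.\<close>
    moreover have "{(\<Sum>i\<in>UNIV. y $ i / V $ i) / (2 * \<beta>\<^sup>2)..1 / \<beta>} \<subseteq> ?A"
    proof
      fix u assume u: "u \<in> {(\<Sum>i\<in>UNIV. y $ i / V $ i) / (2 * \<beta>\<^sup>2)..1 / \<beta>}"
      have ratio: "0 \<le> y $ i / V $ i" for i
        using y V(2)[of i] by simp
      have "0 \<le> (\<Sum>i\<in>UNIV. y $ i / V $ i) / (2 * \<beta>\<^sup>2)"
        using ratio by (simp add: sum_nonneg)
      with u have "T u = 2 * \<beta>\<^sup>2 * u"
        by (simp add: T_def ramp_def)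
      moreover have "(\<Sum>i\<in>UNIV. y $ i / V $ i) \<le> 2 * \<beta>\<^sup>2 * u"
        using u \<beta> by (simp add: field_simps)
      moreover have "y $ i / V $ i \<le> (\<Sum>i\<in>UNIV. y $ i / V $ i)" for i
        using ratio by (intro member_le_sum) auto
      ultimately have "y $ i / V $ i \<le> T u" for i
        by (metis order_trans)
      then have "y $ i \<le> T u * V $ i" for i
        by (simp add: pos_divide_le_eq[OF V(2), symmetric])
      then show "u \<in> ?A"
        by (simp add: covered_def V(1)[symmetric] sum_distrib_left mult_ac)
    qed
    moreover have "0 \<le> (\<Sum>i\<in>UNIV. y $ i / V $ i) / (2 * \<beta>\<^sup>2)"
      using y V(2) by (intro divide_nonneg_nonneg sum_nonneg) (auto simp: less_imp_le)
    moreover have "1 / \<beta> \<le> 1" using \<beta> by simp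
    ultimately have "?g y \<le> measure unit_uniform ?A"
      by (rule measure_unit_uniform_ge)
    also have "\<dots> = measure FX {x. (x, y) \<in> covered W}"
      unfolding FX_def by (subst measure_distr[OF meas measurable_slices(2)]) simp
    finally show ?thesis .
  qed
  have mean: "has_bochner_integral FY ?g (1 / \<beta> - (\<Sum>i\<in>UNIV. Y $ i / V $ i) / (2 * \<beta>\<^sup>2))"
    using FY
    by (intro has_bochner_integral_diff has_bochner_integral_divide_zero has_bochner_integral_sum)
       (auto simp: attacker_strategies_def has_bochner_integral_iff DY.prob_space)
  have "AE y in FY. \<forall>i. 0 \<le> y $ i"
    using FY by (simp add: attacker_strategies_def)
  then have "AE y in FY. ?g y \<le> measure FX {x. (x, y) \<in> covered W}"
    by (rule AE_mp) (use slice in auto)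
  then have "(LINT y|FY. ?g y) \<le> (LINT y|FY. measure FX {x. (x, y) \<in> covered W})"
    using mean has_bochner_integral_attacker_slices[OF FX FY]
    by (intro integral_mono_AE) (auto simp: has_bochner_integral_iff)
  then show "1 / \<beta> - (\<Sum>i\<in>UNIV. Y $ i / V $ i) / (2 * \<beta>\<^sup>2) \<le> defender_payoff W FX FY"
    unfolding has_bochner_integral_integral_eq[OF mean]
      has_bochner_integral_integral_eq[OF has_bochner_integral_attacker_slices[OF FX FY]] .
qed

text \<open>At most one coordinate of the attack is positive, so the defender survives either
  because no target is struck or because the struck target absorbs its attack. The first case has a
  fixed probability, and the second is bounded linearly in \<open>v\<close>.\<close>

lemma single_target_attacker:
  fixes Y V :: "real ^ 2"
  assumes Y: "\<And>i. 0 < Y $ i" and V: "\<And>i. 0 < V $ i"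
    and \<beta>: "1 \<le> \<beta>" "(\<Sum>i\<in>UNIV. Y $ i / V $ i) \<le> \<beta>"
  obtains FY where "FY \<in> attacker_strategies Y"
    "\<And>v. (\<And>i. 0 \<le> v $ i) \<Longrightarrow> measure FY {y. \<forall>i. y $ i \<le> v $ i} \<le>
       1 - (\<Sum>i\<in>UNIV. Y $ i / V $ i) / \<beta> + (\<Sum>i\<in>UNIV. Y $ i / (V $ i)\<^sup>2 * v $ i) / (2 * \<beta>\<^sup>2)"
proof
  \<comment> \<open>\<open>p i\<close> is the probability of striking target \<open>i\<close>. The
    slope \<open>k i\<close> makes the attack there uniform up to
    \<open>k i * p i = 2 * \<beta> * V $ i\<close>, with overall mean \<open>Y $ i\<close>.\<close>
  define p where "p i = Y $ i / V $ i / \<beta>" for i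
  define k where "k i = 2 * \<beta>\<^sup>2 * (V $ i)\<^sup>2 / Y $ i" for i
  define y where "y u = (vector [ramp (k 1) 0 (p 1) u, ramp (k 2) (p 1) (p 1 + p 2) u] :: real ^ 2)" for u
  define FY where "FY = distr unit_uniform borel y"
  have p_pos: "0 < p i" and k_pos: "0 < k i" for i
    using Y[of i] V[of i] \<beta>(1) by (auto simp: p_def k_def)
  have p_sum: "p 1 + p 2 \<le> 1"
    using \<beta> by (simp only: p_def sum_2 add_divide_distrib[symmetric] divide_le_eq_1) simp
  have kp: "k i * (p i)\<^sup>2 / 2 = Y $ i" for i
    using Y[of i] V[of i] \<beta>(1) by (simp add: p_def k_def field_simps power2_eq_square)
  have y_nth: "y u $ 1 = ramp (k 1) 0 (p 1) u" "y u $ 2 = ramp (k 2) (p 1) (p 1 + p 2) u" for u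
    by (simp_all add: y_def)
  have meas: "y \<in> measurable unit_uniform borel"
  proof -
    have "(\<lambda>u. y u $ i) \<in> borel_measurable borel" for i
      using exhaust_2[of i] by (auto simp: y_nth)
    then show ?thesis
      by (subst borel_measurable_euclidean_space)
         (auto simp: Basis_vec_def inner_axis measurable_cong_sets[OF sets_unit_uniform refl])
  qed
  have "AE y in FY. \<forall>i. 0 \<le> y $ i"
  proof -
    have "closed {y :: real ^ 2. \<forall>i. 0 \<le> y $ i}"
      by (intro closed_Collect_all closed_Collect_le continuous_intros)
    then show ?thesis
      unfolding FY_def using k_pos
      by (subst AE_distr_iff[OF meas]) (auto simp: forall_2 y_nth less_imp_le intro!: ramp_nonneg)
  qed
  moreover have "has_bochner_integral FY (\<lambda>y. y $ i) (Y $ i)" for i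
    unfolding FY_def
  proof (rule has_bochner_integral_distr[OF _ meas])
    show "(\<lambda>y :: real ^ 2. y $ i) \<in> borel_measurable borel"
      by (intro borel_measurable_continuous_onI continuous_intros)
    show "has_bochner_integral unit_uniform (\<lambda>u. y u $ i) (Y $ i)"
      using exhaust_2[of i] p_sum p_pos[of 1] p_pos[of 2] k_pos[of 1] k_pos[of 2] kp[of 1] kp[of 2]
        has_bochner_integral_ramp[of "k 1" 0 "p 1"]
        has_bochner_integral_ramp[of "k 2" "p 1" "p 1 + p 2"]
      by (auto simp: y_nth)
  qed
  moreover have "prob_space FY" "sets FY = sets borel"
    by (auto simp: FY_def intro!: unit_uniform.prob_space_distr meas)
  ultimately show "FY \<in> attacker_strategies Y"
    by (simp add: attacker_strategies_def)

  fix v :: "real ^ 2"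
  assume v: "\<And>i. 0 \<le> v $ i"
  let ?S = "{y :: real ^ 2. \<forall>i. y $ i \<le> v $ i}"
  have "closed ?S"
    by (intro closed_Collect_all closed_Collect_le continuous_intros)
  then have S: "?S \<in> sets borel" by simp
  have A: "y -` ?S \<in> sets borel"
    using measurable_sets[OF meas S] by simp
  \<comment> \<open>Survivable strikes on target 1, survivable strikes on target 2, and no strike.
    The first two intervals are deliberately not cut off at the ends of the ramps: the overshoot
    only weakens the bound and keeps it linear in \<open>v\<close>.\<close>
  let ?B1 = "{0..v $ 1 / k 1}" and ?B2 = "{p 1..p 1 + v $ 2 / k 2}" and ?B3 = "{p 1 + p 2..1}"
  have sub: "{0..1} \<inter> y -` ?S \<subseteq> ?B1 \<union> ?B2 \<union> ?B3"
  proof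
    fix u assume "u \<in> {0..1} \<inter> y -` ?S"
    then have u: "0 \<le> u" "u \<le> 1" "ramp (k 1) 0 (p 1) u \<le> v $ 1"
      "ramp (k 2) (p 1) (p 1 + p 2) u \<le> v $ 2"
      by (auto simp: forall_2 y_nth)
    consider "u \<le> p 1" | "p 1 \<le> u" "u \<le> p 1 + p 2" | "p 1 + p 2 \<le> u" by linarith
    then show "u \<in> ?B1 \<union> ?B2 \<union> ?B3"
    proof cases
      case 1
      then have "u \<in> ?B1"
        using u k_pos[of 1] by (simp add: ramp_def pos_le_divide_eq mult.commute)
      then show ?thesis by simp
    next
      case 2
      then have "u - p 1 \<le> v $ 2 / k 2"
        using u k_pos[of 2] by (simp add: ramp_def pos_le_divide_eq mult.commute)
      then show ?thesis using 2 by simp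
    qed (use u in simp)
  qed
  have "measure FY ?S = measure unit_uniform (y -` ?S)"
    unfolding FY_def by (subst measure_distr[OF meas S]) simp
  also have "\<dots> \<le> measure unit_uniform (?B1 \<union> ?B2 \<union> ?B3)"
    using A sub by (intro measure_unit_uniform_mono) auto
  also have "\<dots> \<le> measure unit_uniform ?B1 + measure unit_uniform ?B2 + measure unit_uniform ?B3"
    using measure_Un_le[of "?B1 \<union> ?B2" unit_uniform ?B3] measure_Un_le[of ?B1 unit_uniform ?B2]
    by simp
  also have "\<dots> \<le> v $ 1 / k 1 + v $ 2 / k 2 + (1 - (p 1 + p 2))"
    using measure_unit_uniform_atLeastAtMost_le[of 0 "v $ 1 / k 1"]
      measure_unit_uniform_atLeastAtMost_le[of "p 1" "p 1 + v $ 2 / k 2"]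
      measure_unit_uniform_atLeastAtMost_le[OF p_sum] v k_pos[of 1] k_pos[of 2]
    by (simp add: less_imp_le)
  also have "\<dots> = 1 - (\<Sum>i\<in>UNIV. Y $ i / V $ i) / \<beta> + (\<Sum>i\<in>UNIV. Y $ i / (V $ i)\<^sup>2 * v $ i) / (2 * \<beta>\<^sup>2)"
    by (simp add: sum_2 p_def k_def add_divide_distrib mult_ac)
  finally show "measure FY ?S \<le> \<dots>" .
qed

section \<open>First-order conditions for the optimal split\<close>

text \<open>With \<alpha> viewed as a function of \<open>s\<close>, its derivative is
  \<open>X2 * (Y2 / V2\<^sup>2 * w22 - Y1 / V1\<^sup>2 * w21)\<close>. The last two claims say that
  it is nonnegative and vanishes unless \<open>s = 0\<close>, the optimality conditions for the
  constraint \<open>0 \<le> s\<close>.\<close>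

lemma split_optimality:
  fixes X1 X2 Y1 Y2 w21 w22 s :: real
  assumes pos: "X1 > 0" "X2 > 0" "Y1 > 0" "Y2 > 0" "w21 > 0" "w22 > 0"
    and s: "s = min 1 (max 0 ((sqrt (Y1 * w21) * X2 - sqrt (Y2 / w22) * X1) /
                           (X2 * (sqrt (Y1 * w21) + w21 * sqrt (Y2 / w22)))))"
  defines "V1 \<equiv> X1 + s * w21 * X2" and "V2 \<equiv> (1 - s) * w22 * X2"
  shows "0 \<le> s" "s < 1"
    and "Y1 / V1\<^sup>2 * w21 \<le> Y2 / V2\<^sup>2 * w22"
    and "s * (Y1 / V1\<^sup>2 * w21) = s * (Y2 / V2\<^sup>2 * w22)"
proof -
  define A B where "A = sqrt (Y1 * w21)" and "B = sqrt (Y2 / w22)"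
  have AB: "0 < A" "0 < B" "A\<^sup>2 = Y1 * w21" "B\<^sup>2 = Y2 / w22"
    using pos by (auto simp: A_def B_def)
  define D where "D = X2 * (A + w21 * B)"
  have D: "0 < D" using pos AB by (simp add: D_def add_pos_pos)
  \<comment> \<open>The gap is \<open>B * (X1 + w21 * X2)\<close>, so the clamp at 1 in
    \<open>s\<close> never acts: target 2 always keeps some of the second resource.\<close>
  have "A * X2 - B * X1 < D"
    using pos AB by (simp add: D_def algebra_simps) (smt (verit) mult_pos_pos)
  then have lt: "(A * X2 - B * X1) / D < 1" using D by simp
  have s': "s = max 0 ((A * X2 - B * X1) / D)"
    using s lt by (simp add: A_def B_def D_def)
  show s0: "0 \<le> s" and s1: "s < 1" using s' lt by auto
  have V: "0 < V1" "0 < V2"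
    using pos s0 s1 by (auto simp: V1_def V2_def add_pos_nonneg)
  \<comment> \<open>Square roots of the two marginal values are compared by cross-multiplication.
    The difference is affine in \<open>s\<close>, and its zero is the unclamped formula for
    \<open>s\<close>.\<close>
  have gap: "A * (V2 / w22) - B * V1 = A * X2 - B * X1 - s * D"
    using pos by (simp add: V1_def V2_def D_def field_simps)
  have sD: "s * D = max 0 (A * X2 - B * X1)"
    using D by (simp add: s' max_mult_distrib_right)
  have "A * (V2 / w22) \<le> B * V1" using gap sD by simp
  then have le: "A / V1 \<le> B * w22 / V2"
    using V pos by (simp add: field_simps)
  have eq: "A / V1 = B * w22 / V2" if "s \<noteq> 0"
  proof -
    have "s * D \<noteq> 0" using that D by simp
    then have "A * (V2 / w22) = B * V1" using gap sD by (auto simp: max_def split: if_splits)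
    then show ?thesis using V pos by (simp add: field_simps)
  qed
  have sq: "Y1 / V1\<^sup>2 * w21 = (A / V1)\<^sup>2" "Y2 / V2\<^sup>2 * w22 = (B * w22 / V2)\<^sup>2"
    using pos by (simp_all add: power_divide power_mult_distrib AB) (simp add: power2_eq_square)
  show "Y1 / V1\<^sup>2 * w21 \<le> Y2 / V2\<^sup>2 * w22"
    unfolding sq using le V AB by (intro power_mono) auto
  show "s * (Y1 / V1\<^sup>2 * w21) = s * (Y2 / V2\<^sup>2 * w22)"
    unfolding sq using eq by (cases "s = 0") simp_all
qed

section \<open>Matching guarantees and the value\<close>

theorem theorem4:
  fixes X1 X2 Y1 Y2 w21 w22 s \<alpha> :: real
    and X Y :: "real ^ 2" and W :: "real ^ 2 ^ 2"
  assumes "X1 > 0" "X2 > 0" "Y1 > 0" "Y2 > 0" "w21 > 0" "w22 > 0"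
    and "X = vector [X1, X2]" and "Y = vector [Y1, Y2]"
    and "W = vector [vector [1, 0], vector [w21, w22]]"
    and "s = min 1 (max 0 ((sqrt (Y1 * w21) * X2 - sqrt (Y2 / w22) * X1) /
                           (X2 * (sqrt (Y1 * w21) + w21 * sqrt (Y2 / w22)))))"
    and "\<alpha> = Y1 / (X1 + s * w21 * X2) + Y2 / ((1 - s) * w22 * X2)"
  shows "\<exists>V. is_equilibrium_value W X Y V \<and>
             (\<alpha> \<le> 1 \<longrightarrow> V = 1 - \<alpha> / 2) \<and>
             (\<alpha> \<ge> 1 \<longrightarrow> V = 1 / (2 * \<alpha>))"
proof -
  note pos = assms(1-6)
  note opt = split_optimality[OF pos assms(10)]
  define V1 V2 where "V1 = X1 + s * w21 * X2" and "V2 = (1 - s) * w22 * X2"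
  define l1 l2 where "l1 = Y1 / V1\<^sup>2" and "l2 = Y2 / V2\<^sup>2"
  define V :: "real ^ 2" where "V = vector [V1, V2]"
  \<comment> \<open>One parameter serves both regimes: the defender puts an atom at 0 when
    \<open>\<alpha> > 1\<close>, the attacker when \<open>\<alpha> < 1\<close>.\<close>
  define \<beta> where "\<beta> = max 1 \<alpha>"
  \<comment> \<open>Rows are attack types. Resource 1 is worthless against type 2, so all of it goes
    to type 1, and only resource 2 is split.\<close>
  define x0 :: "real ^ 2 ^ 2" where "x0 = vector [vector [X1, s * X2], vector [0, (1 - s) * X2]]"
  have V_pos: "0 < V1" "0 < V2"
    using pos opt(1,2) by (auto simp: V1_def V2_def add_pos_nonneg)
  have l_pos: "0 < l1" "0 < l2" using pos V_pos by (auto simp: l1_def l2_def)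
  have \<alpha>: "\<alpha> = Y1 / V1 + Y2 / V2" by (simp add: assms(11) V1_def V2_def)
  have \<alpha>_sum: "(\<Sum>i\<in>UNIV. Y $ i / V $ i) = \<alpha>"
    by (simp add: sum_2 \<alpha> V_def assms(8))
  have \<beta>: "1 \<le> \<beta>" "\<alpha> \<le> \<beta>" by (auto simp: \<beta>_def)

  obtain FX where FX: "FX \<in> defender_strategies X"
    and lower: "\<And>FY. FY \<in> attacker_strategies Y \<Longrightarrow>
       1 / \<beta> - \<alpha> / (2 * \<beta>\<^sup>2) \<le> defender_payoff W FX FY"
  proof (rule proportional_defender[of x0 X W V \<beta>])
    show "0 \<le> x0 $ i $ j" for i j
      using exhaust_2[of i] exhaust_2[of j] pos opt(1,2) by (auto simp: x0_def)
    show "(\<Sum>i\<in>UNIV. x0 $ i $ j) = X $ j" for j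
      using exhaust_2[of j] by (auto simp: sum_2 x0_def assms(7) algebra_simps)
    show "(\<Sum>j\<in>UNIV. W $ j $ i * x0 $ i $ j) = V $ i" for i
      using exhaust_2[of i] by (auto simp: sum_2 x0_def assms(9) V_def V1_def V2_def)
    show "0 < V $ i" for i
      using exhaust_2[of i] V_pos by (auto simp: V_def)
  qed (use \<beta> \<alpha>_sum in auto)

  obtain FY where FY: "FY \<in> attacker_strategies Y"
    and FY_le: "\<And>v. (\<And>i. 0 \<le> v $ i) \<Longrightarrow> measure FY {y. \<forall>i. y $ i \<le> v $ i} \<le>
       1 - \<alpha> / \<beta> + (l1 * v $ 1 + l2 * v $ 2) / (2 * \<beta>\<^sup>2)"
  proof (rule single_target_attacker[of Y V \<beta>])
    show "0 < Y $ i" "0 < V $ i" for i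
      using exhaust_2[of i] V_pos pos by (auto simp: V_def assms(8))
  qed (use \<beta> \<alpha>_sum in \<open>auto simp: sum_2 V_def assms(8) l1_def l2_def\<close>)

  \<comment> \<open>Complementary slackness of the optimal split: the prices \<open>l1\<close> and \<open>l2 * w22\<close> of the two
    resources make the total budget worth exactly \<open>\<alpha>\<close>.\<close>
  have price: "l1 * X1 + l2 * w22 * X2 = \<alpha>"
  proof -
    have "l1 * V1 + l2 * V2 = l1 * X1 + s * (l1 * w21) * X2 + (1 - s) * (l2 * w22) * X2"
      by (simp add: V1_def V2_def algebra_simps)
    also have "s * (l1 * w21) = s * (l2 * w22)"
      using opt(4) by (simp add: l1_def l2_def V1_def V2_def)
    finally have "l1 * V1 + l2 * V2 = l1 * X1 + l2 * w22 * X2"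
      by (simp add: algebra_simps)
    moreover have "l1 * V1 + l2 * V2 = \<alpha>"
      using V_pos by (simp add: \<alpha> l1_def l2_def power2_eq_square)
    ultimately show ?thesis by simp
  qed
  have upper: "defender_payoff W F FY \<le> 1 - \<alpha> / \<beta> + \<alpha> / (2 * \<beta>\<^sup>2)"
    if F: "F \<in> defender_strategies X" for F
  proof -
    interpret F: prob_space F using F by (simp add: defender_strategies_def)
    let ?g = "\<lambda>x :: real ^ 2 ^ 2. 1 - \<alpha> / \<beta> +
      (l1 * (\<Sum>i\<in>UNIV. x $ i $ 1) + l2 * w22 * (\<Sum>i\<in>UNIV. x $ i $ 2)) / (2 * \<beta>\<^sup>2)"
    have slice: "measure FY {y. (x, y) \<in> covered W} \<le> ?g x" if x: "\<forall>i j. 0 \<le> x $ i $ j" for x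
    proof -
      define v :: "real ^ 2" where "v = (\<chi> i. \<Sum>j\<in>UNIV. W $ j $ i * x $ i $ j)"
      have v: "v $ 1 = x $ 1 $ 1 + w21 * x $ 1 $ 2" "v $ 2 = w22 * x $ 2 $ 2"
        by (simp_all add: v_def sum_2 assms(9))
      have "measure FY {y. (x, y) \<in> covered W} = measure FY {y. \<forall>i. y $ i \<le> v $ i}"
        by (simp add: covered_def v_def)
      also have "\<dots> \<le> 1 - \<alpha> / \<beta> + (l1 * v $ 1 + l2 * v $ 2) / (2 * \<beta>\<^sup>2)"
      proof (rule FY_le)
        show "0 \<le> v $ i" for i
          using exhaust_2[of i] x pos by (auto simp: v)
      qed
      \<comment> \<open>Each resource is revalued at its best use: resource 2 is worth at most
        \<open>l2 * w22\<close> per unit at either target, and resource 1 at most \<open>l1\<close>.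
        The bound then involves only total amounts, whose means are the budgets.\<close>
      also have "\<dots> \<le> ?g x"
      proof -
        have "l1 * w21 * x $ 1 $ 2 \<le> l2 * w22 * x $ 1 $ 2"
          using opt(3) x by (intro mult_right_mono) (auto simp: l1_def l2_def V1_def V2_def)
        moreover have "0 \<le> l1 * x $ 2 $ 1" using x l_pos by simp
        ultimately have "l1 * v $ 1 + l2 * v $ 2 \<le>
            l1 * (\<Sum>i\<in>UNIV. x $ i $ 1) + l2 * w22 * (\<Sum>i\<in>UNIV. x $ i $ 2)"
          by (simp add: v sum_2 algebra_simps)
        then show ?thesis by (simp add: divide_right_mono)
      qed
      finally show ?thesis .
    qed
    have "has_bochner_integral F (\<lambda>x. \<Sum>i\<in>UNIV. x $ i $ j) (X $ j)" for j
      using F by (simp add: defender_strategies_def)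
    then have mean: "has_bochner_integral F ?g
        (1 - \<alpha> / \<beta> + (l1 * X $ 1 + l2 * w22 * X $ 2) / (2 * \<beta>\<^sup>2))"
      by (intro has_bochner_integral_add has_bochner_integral_divide_zero
          has_bochner_integral_mult_right)
         (auto simp: has_bochner_integral_iff F.prob_space)
    have "AE x in F. \<forall>i j. 0 \<le> x $ i $ j"
      using F by (simp add: defender_strategies_def)
    then have "AE x in F. measure FY {y. (x, y) \<in> covered W} \<le> ?g x"
      by (rule AE_mp) (use slice in auto)
    then have "(LINT x|F. measure FY {y. (x, y) \<in> covered W}) \<le> (LINT x|F. ?g x)"
      using mean has_bochner_integral_defender_slices[OF F FY]
      by (intro integral_mono_AE) (auto simp: has_bochner_integral_iff)
    then show ?thesis
      unfolding has_bochner_integral_integral_eq[OF mean]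
        has_bochner_integral_integral_eq[OF has_bochner_integral_defender_slices[OF F FY]]
      using price by (simp add: assms(7))
  qed

  \<comment> \<open>The difference of the sides is
    \<open>(1 - 1 / \<beta>) * (1 - \<alpha> / \<beta>)\<close>, which vanishes because \<beta> is
    either 1 or \<alpha>.\<close>
  have "1 - \<alpha> / \<beta> + \<alpha> / (2 * \<beta>\<^sup>2) = 1 / \<beta> - \<alpha> / (2 * \<beta>\<^sup>2)"
    by (auto simp: \<beta>_def max_def power2_eq_square)
  with upper have "is_equilibrium_value W X Y (1 / \<beta> - \<alpha> / (2 * \<beta>\<^sup>2))"
    by (intro saddle_point_is_value[OF FX FY lower]) metis+
  moreover have "\<alpha> \<le> 1 \<longrightarrow> 1 / \<beta> - \<alpha> / (2 * \<beta>\<^sup>2) = 1 - \<alpha> / 2"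
    by (simp add: \<beta>_def)
  moreover have "\<alpha> \<ge> 1 \<longrightarrow> 1 / \<beta> - \<alpha> / (2 * \<beta>\<^sup>2) = 1 / (2 * \<alpha>)"
    by (auto simp: \<beta>_def max_def power2_eq_square)
  ultimately show ?thesis by blast
qed

end
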